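(* Consider the plant, the data matrices $U_1,\Psi_0,\Psi_1$, the unknown matrix $W_0$, and the matrices $\bar{\mathbf A},\bar{\mathbf B}$ defined in the context. Assume that all eigenvalues of $S$ belong to $\{z\in\mathbb{C}: |z|\ge 1\}$ and that the pair $(A,C)$ is observable with (known) observability index $\ell$. Let a matrix $\hat L_0$ and a (known) matrix $\hat{\mathbf M}\in\mathbb{R}^{\hat n_w\times(T-\ell+1)}$ be such that $W_0=\hat L_0\hat{\mathbf M}$, and let $N:=(m+p)\ell+pd$. If there are matrices $\mathcal K\in\mathbb{R}^{m\times N}$ and $\mathcal G\in\mathbb{R}^{(T-\ell+1)\times N}$ such that $$\begin{bmatrix}\mathcal K\\ I_N\\ 0_{\hat n_w,N}\end{bmatrix}=\begin{bmatrix}U_1\\ \Psi_0\\ \hat{\mathbf M}\end{bmatrix}\mathcal G,$$ then $\bar{\mathbf A}+\bar{\mathbf B}\mathcal K=\Psi_1\mathcal G$.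
   Context: All vectors and matrices are real. $x^+$ denotes the value of $x$ at the next time step (discrete time); $(x_1,\dots,x_k)$ denotes the stacked column vector. Plant: $w^+=Sw$, $x^+=Ax+Bu+Pw$, $y=Cx+Qw$ with $w\in\mathbb{R}^{n_w}$ (exosignal), $x\in\mathbb{R}^n$, $u\in\mathbb{R}^m$, $y\in\mathbb{R}^p$. Observability index: if $(A,C)$ is observable, $\ell$ is the smallest integer $l\ge1$ such that the stacked matrix with block rows $C,CA,\dots,CA^{l-1}$ has rank $n$. Internal model: let $\lambda^d+s_{d-1}\lambda^{d-1}+\dots+s_1\lambda+s_0$ be the minimal polynomial of $S$. $\Phi\in\mathbb{R}^{pd\times pd}$ is the block companion matrix with $d\times d$ blocks of size $p\times p$: for $i=1,\dots,d-1$ its $i$-th block row has $I_p$ in block column $i+1$ and zeros elsewhere, and its last block row is $[-s_0I_p,\,-s_1I_p,\dots,-s_{d-1}I_p]$. $G\in\mathbb{R}^{pd\times p}$ has $I_p$ as last block and zeros elsewhere. The internal model is $\eta^+=\Phi\eta+Gy$. Data: for an integer $T\ge\ell$, a trajectory of the plant and of the internal model is collected (arbitrary initial $w(0),x(0),\eta(0)$ and input sequence $u(0),\dots,u(T)$). For $k=\ell,\dots,T+1$ let $\psi(k):=(y(k-\ell),\dots,y(k-1),u(k-\ell),\dots,u(k-1),\eta(k))\in\mathbb{R}^{(m+p)\ell+pd}$. Define $U_1:=[u(\ell)\ u(\ell+1)\ \cdots\ u(T)]$, $\Psi_0:=[\psi(\ell)\ \psi(\ell+1)\ \cdots\ \psi(T)]$,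 $\Psi_1:=[\psi(\ell+1)\ \psi(\ell+2)\ \cdots\ \psi(T+1)]$, $W_0:=[w(\ell)\ w(\ell+1)\ \cdots\ w(T)]$. Matrices: $\mathcal O$ is the matrix with block rows $C,CA,\dots,CA^{\ell-1}$ and $\mathcal O^{\mathrm L}$ is a (fixed) left inverse, $\mathcal O^{\mathrm L}\mathcal O=I_n$. $\mathcal T_{\mathrm u}\in\mathbb{R}^{p\ell\times m\ell}$ has $(i,j)$ block $CA^{i-j-1}B$ for $i>j$ and $0$ for $i\le j$ ($1\le i,j\le\ell$). $\mathcal R_{\mathrm u}:=[A^{\ell-1}B\ \cdots\ AB\ B]$. $Z_1:=[\,CA^\ell\mathcal O^{\mathrm L}\ \ \ C\mathcal R_{\mathrm u}-CA^\ell\mathcal O^{\mathrm L}\mathcal T_{\mathrm u}\,]$. On $\mathbb{R}^{(p+m)\ell}$, with vectors partitioned as $(a_1,\dots,a_\ell,b_1,\dots,b_\ell)$, $a_i\in\mathbb{R}^p$, $b_i\in\mathbb{R}^m$: $\mathbf F$ is the matrix of $(a_1,\dots,a_\ell,b_1,\dots,b_\ell)\mapsto(a_2,\dots,a_\ell,0,b_2,\dots,b_\ell,0)$; $\mathbf L\in\mathbb{R}^{(p+m)\ell\times p}$ is the matrix of $a\mapsto(0,\dots,0,a,0,\dots,0)$ with $a$ in position $a_\ell$; $\mathbf B\in\mathbb{R}^{(p+m)\ell\times m}$ is the matrix of $b\mapsto(0,\dots,0,b)$ with $b$ in position $b_\ell$. $\mathbf A:=\mathbf F+\mathbf LZ_1$.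 $\bar{\mathbf A}:=\begin{bmatrix}\mathbf A&0\\ GZ_1&\Phi\end{bmatrix}$, $\bar{\mathbf B}:=\begin{bmatrix}\mathbf B\\0\end{bmatrix}$. *)

theory Defs
  imports
    "Jordan_Normal_Form.Char_Poly"
    "Jordan_Normal_Form.DL_Rank"
    "HOL-Computational_Algebra.Polynomial"
begin

(* The dimensions in play (observability index, degree of the minimal polynomial, number of
   data columns) are terms, so matrices and vectors are those of Jordan_Normal_Form, with
   carriers. All indices, including block indices, start at 0. *)

(* The matrix with r x c blocks of size nr x nc whose (i,j) block is F i j. *)
definition block_mat :: "nat \<Rightarrow> nat \<Rightarrow> nat \<Rightarrow> nat \<Rightarrow> (nat \<Rightarrow> nat \<Rightarrow> real mat) \<Rightarrow> real mat" where
  "block_mat nr nc r c F =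
     mat (nr * r) (nc * c) (\<lambda>(i, j). F (i div nr) (j div nc) $$ (i mod nr, j mod nc))"

(* The stacked vector (f 0, ..., f (r - 1)), each f i of dimension nr. *)
definition stack_vec :: "nat \<Rightarrow> nat \<Rightarrow> (nat \<Rightarrow> real vec) \<Rightarrow> real vec" where
  "stack_vec nr r f = vec (nr * r) (\<lambda>i. f (i div nr) $ (i mod nr))"

definition block_row :: "real mat \<Rightarrow> real mat \<Rightarrow> real mat" where
  "block_row M1 M2 =
     four_block_mat M1 M2 (0\<^sub>m 0 (dim_col M1)) (0\<^sub>m 0 (dim_col M2))"

definition poly_mat_eval :: "real poly \<Rightarrow> real mat \<Rightarrow> real mat" where
  "poly_mat_eval q S =
     mat (dim_row S) (dim_row S) (\<lambda>ij. \<Sum>k\<le>degree q. coeff q k * (S ^\<^sub>m k) $$ ij)"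

definition annihilates :: "real poly \<Rightarrow> real mat \<Rightarrow> bool" where
  "annihilates q S \<longleftrightarrow> poly_mat_eval q S = 0\<^sub>m (dim_row S) (dim_row S)"

definition is_min_poly :: "real mat \<Rightarrow> real poly \<Rightarrow> bool" where
  "is_min_poly S q \<longleftrightarrow> lead_coeff q = 1 \<and> annihilates q S \<and>
     (\<forall>r. r \<noteq> 0 \<and> annihilates r S \<longrightarrow> degree q \<le> degree r)"

(* The initial state of x+ = A x, y = C x is determined by the output sequence. *)
definition observable :: "real mat \<Rightarrow> real mat \<Rightarrow> bool" where
  "observable A C \<longleftrightarrow>
     (\<forall>x \<in> carrier_vec (dim_row A). \<forall>x' \<in> carrier_vec (dim_row A).
        (\<forall>k. C *\<^sub>v (A ^\<^sub>m k *\<^sub>v x) = C *\<^sub>v (A ^\<^sub>m k *\<^sub>v x')) \<longrightarrow> x = x')"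

definition obsv_mat :: "real mat \<Rightarrow> real mat \<Rightarrow> nat \<Rightarrow> real mat" where
  "obsv_mat A C l = block_mat (dim_row C) (dim_row A) l 1 (\<lambda>i _. C * A ^\<^sub>m i)"

definition mat_rank :: "real mat \<Rightarrow> nat" where
  "mat_rank M = vec_space.rank (dim_row M) M"

definition is_obsv_index :: "real mat \<Rightarrow> real mat \<Rightarrow> nat \<Rightarrow> bool" where
  "is_obsv_index A C l \<longleftrightarrow>
     1 \<le> l \<and> mat_rank (obsv_mat A C l) = dim_row A \<and>
     (\<forall>l'. 1 \<le> l' \<and> mat_rank (obsv_mat A C l') = dim_row A \<longrightarrow> l \<le> l')"

(* q is the minimal polynomial of S, monic of degree d; coeff q j is s_j for j < d. *)
definition im_Phi :: "nat \<Rightarrow> real poly \<Rightarrow> real mat" where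
  "im_Phi p q = (let d = degree q in
     block_mat p p d d (\<lambda>i j.
       if Suc i < d then (if j = Suc i then 1\<^sub>m p else 0\<^sub>m p p)
       else (- coeff q j) \<cdot>\<^sub>m 1\<^sub>m p))"

definition last_block :: "nat \<Rightarrow> nat \<Rightarrow> real mat" where
  "last_block nr r = block_mat nr nr r 1 (\<lambda>i _. if Suc i = r then 1\<^sub>m nr else 0\<^sub>m nr nr)"

definition im_G :: "nat \<Rightarrow> real poly \<Rightarrow> real mat" where
  "im_G p q = last_block p (degree q)"

(* Meant for k \<ge> l; the subtraction on nat is then exact. *)
definition psi_vec ::
  "nat \<Rightarrow> nat \<Rightarrow> nat \<Rightarrow> (nat \<Rightarrow> real vec) \<Rightarrow> (nat \<Rightarrow> real vec) \<Rightarrow> (nat \<Rightarrow> real vec) \<Rightarrow> nat \<Rightarrow> real vec" where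
  "psi_vec p m l y u \<eta> k =
     stack_vec p l (\<lambda>i. y (k - l + i)) @\<^sub>v stack_vec m l (\<lambda>i. u (k - l + i)) @\<^sub>v \<eta> k"

(* The matrix with columns v a, v (a + 1), ..., v b, each of dimension nr. *)
definition data_mat :: "nat \<Rightarrow> (nat \<Rightarrow> real vec) \<Rightarrow> nat \<Rightarrow> nat \<Rightarrow> real mat" where
  "data_mat nr v a b = mat_of_cols nr (map v [a..<Suc b])"

definition Tu_mat :: "real mat \<Rightarrow> real mat \<Rightarrow> real mat \<Rightarrow> nat \<Rightarrow> real mat" where
  "Tu_mat A B C l = block_mat (dim_row C) (dim_col B) l l
     (\<lambda>i j. if j < i then C * A ^\<^sub>m (i - j - 1) * B else 0\<^sub>m (dim_row C) (dim_col B))"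

definition Ru_mat :: "real mat \<Rightarrow> real mat \<Rightarrow> nat \<Rightarrow> real mat" where
  "Ru_mat A B l = block_mat (dim_row A) (dim_col B) 1 l (\<lambda>_ j. A ^\<^sub>m (l - 1 - j) * B)"

(* Along plant trajectories, y(k) = Z1 (y(k-l), ..., y(k-1), u(k-l), ..., u(k-1)) + (terms in w);
   OL is a left inverse of obsv_mat A C l. *)
definition Z1_mat :: "real mat \<Rightarrow> real mat \<Rightarrow> real mat \<Rightarrow> nat \<Rightarrow> real mat \<Rightarrow> real mat" where
  "Z1_mat A B C l OL =
     block_row (C * A ^\<^sub>m l * OL) (C * Ru_mat A B l - C * A ^\<^sub>m l * OL * Tu_mat A B C l)"

(* The matrix of (a_1, ..., a_r) \<mapsto> (a_2, ..., a_r, 0) with blocks a_i of dimension nr. *)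
definition shift_mat :: "nat \<Rightarrow> nat \<Rightarrow> real mat" where
  "shift_mat nr r = block_mat nr nr r r (\<lambda>i j. if j = Suc i then 1\<^sub>m nr else 0\<^sub>m nr nr)"

definition bF_mat :: "nat \<Rightarrow> nat \<Rightarrow> nat \<Rightarrow> real mat" where
  "bF_mat p m l =
     four_block_mat (shift_mat p l) (0\<^sub>m (p * l) (m * l)) (0\<^sub>m (m * l) (p * l)) (shift_mat m l)"

definition bL_mat :: "nat \<Rightarrow> nat \<Rightarrow> nat \<Rightarrow> real mat" where
  "bL_mat p m l = last_block p l @\<^sub>r 0\<^sub>m (m * l) p"

definition bB_mat :: "nat \<Rightarrow> nat \<Rightarrow> nat \<Rightarrow> real mat" where
  "bB_mat p m l = 0\<^sub>m (p * l) m @\<^sub>r last_block m l"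

definition bA_mat :: "nat \<Rightarrow> nat \<Rightarrow> nat \<Rightarrow> real mat \<Rightarrow> real mat" where
  "bA_mat p m l Z1 = bF_mat p m l + bL_mat p m l * Z1"

definition Abar_mat :: "nat \<Rightarrow> nat \<Rightarrow> nat \<Rightarrow> real poly \<Rightarrow> real mat \<Rightarrow> real mat" where
  "Abar_mat p m l q Z1 =
     four_block_mat (bA_mat p m l Z1) (0\<^sub>m ((p + m) * l) (p * degree q))
                    (im_G p q * Z1) (im_Phi p q)"

definition Bbar_mat :: "nat \<Rightarrow> nat \<Rightarrow> nat \<Rightarrow> real poly \<Rightarrow> real mat" where
  "Bbar_mat p m l q = bB_mat p m l @\<^sub>r 0\<^sub>m (p * degree q) m"

end

theory Submission
  imports Defs
begin

text \<open>
  Write \<open>\<psi>\<close> for the vector of the last \<open>l\<close> outputs, the last \<open>l\<close> inputs and the state of the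
  internal model. If there were no exosignal, the plant together with the internal model would
  satisfy \<open>\<psi>\<^sup>+ = Abar \<psi> + Bbar u\<close>: the recorded outputs and inputs determine the state at the
  start of the window through the left inverse of the observability matrix, hence the state at
  its end, hence the next output \<open>Z1 (y, u)\<close> (\<open>output_prediction\<close>), and the remaining rows of
  \<open>Abar\<close> and \<open>Bbar\<close> shift the registers and drive the internal model (\<open>lifted_step\<close>).

  The recorded trajectory is disturbed, so this cannot be applied to it directly. Fix a column
  \<open>g\<close> of \<open>\<G>\<close>. The windows of length \<open>l + 1\<close> that start at the times \<open>0, \<dots>, T - l\<close> are all
  trajectories of the same linear equations, and so is their superposition with the weights \<open>g\<close>.
  Its exosignal at the window position \<open>l\<close> is \<open>W0 g = L0 (M g) = 0\<close>. An exosignal with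
  \<open>w\<^sup>+ = S w\<close> that vanishes at the end of a window has vanished throughout it, because \<open>0\<close> is
  not an eigenvalue of \<open>S\<close>. The superposition is therefore a disturbance-free trajectory, which gives
  \<open>\<Psi>1 g = Abar (\<Psi>0 g) + Bbar (U1 g)\<close> (\<open>lifted_step_superposition\<close>). As \<open>\<Psi>0 g\<close> is a unit vector and
  \<open>U1 g\<close> is a column of \<open>\<K>\<close>, this is the claim, one column at a time.
\<close>

section \<open>Sums of vectors\<close>

text \<open>The dimension is an explicit argument, so that the empty sum is the zero vector of the
  right dimension.\<close>
definition vec_sum :: "nat \<Rightarrow> (nat \<Rightarrow> real vec) \<Rightarrow> nat \<Rightarrow> real vec" where
  "vec_sum n f r = vec n (\<lambda>i. \<Sum>j<r. f j $ i)"

lemma vec_sum_carrier [simp]: "vec_sum n f r \<in> carrier_vec n"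
  by (simp add: vec_sum_def)

lemma dim_vec_sum [simp]: "dim_vec (vec_sum n f r) = n"
  by (simp add: vec_sum_def)

lemma vec_sum_cong: "(\<And>j. j < r \<Longrightarrow> f j = h j) \<Longrightarrow> vec_sum n f r = vec_sum n h r"
  by (auto simp: vec_sum_def)

lemma vec_sum_Suc:
  "f r \<in> carrier_vec n \<Longrightarrow> vec_sum n f (Suc r) = vec_sum n f r + f r"
  by (auto simp: vec_sum_def)

lemma vec_sum_add:
  assumes "\<And>j. j < r \<Longrightarrow> f j \<in> carrier_vec n" "\<And>j. j < r \<Longrightarrow> h j \<in> carrier_vec n"
  shows "vec_sum n (\<lambda>j. f j + h j) r = vec_sum n f r + vec_sum n h r"
proof (rule eq_vecI)
  fix i assume "i < dim_vec (vec_sum n f r + vec_sum n h r)"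
  then have i: "i < n" by simp
  have "(\<Sum>j<r. (f j + h j) $ i) = (\<Sum>j<r. f j $ i + h j $ i)"
  proof (intro sum.cong refl)
    fix j assume "j \<in> {..<r}"
    with i assms(2)[of j] have "i < dim_vec (h j)" by simp
    then show "(f j + h j) $ i = f j $ i + h j $ i" by (rule index_add_vec)
  qed
  then show "vec_sum n (\<lambda>j. f j + h j) r $ i = (vec_sum n f r + vec_sum n h r) $ i"
    using i by (simp add: vec_sum_def sum.distrib)
qed simp

lemma mult_mat_vec_sum:
  assumes M: "M \<in> carrier_mat k n" and f: "\<And>j. j < r \<Longrightarrow> f j \<in> carrier_vec n"
  shows "M *\<^sub>v vec_sum n f r = vec_sum k (\<lambda>j. M *\<^sub>v f j) r"
  using f
proof (induction r)
  case 0
  have "vec_sum n f 0 = 0\<^sub>v n" "vec_sum k (\<lambda>j. M *\<^sub>v f j) 0 = 0\<^sub>v k"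
    by (auto simp: vec_sum_def)
  with M show ?case by auto
next
  case (Suc r)
  then have "f r \<in> carrier_vec n" by simp
  with Suc M show ?case
    by (simp add: vec_sum_Suc mult_add_distrib_mat_vec[OF M])
qed

text \<open>This evaluates a block row with one nonzero block. The case \<open>r \<le> i\<close> serves the last row
  of a shift, whose nonzero block would lie outside the matrix.\<close>

lemma vec_sum_single:
  assumes "\<And>j. j < r \<Longrightarrow> j \<noteq> i \<Longrightarrow> f j = 0\<^sub>v n" "i < r \<Longrightarrow> f i \<in> carrier_vec n"
  shows "vec_sum n f r = (if i < r then f i else 0\<^sub>v n)"
proof (rule eq_vecI)
  fix a assume "a < dim_vec (if i < r then f i else 0\<^sub>v n)"
  then have a: "a < n" using assms(2) by (auto split: if_splits)
  have "(\<Sum>j<r. f j $ a) = (\<Sum>j<r. if j = i then f i $ a else 0)"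
    using assms a by (intro sum.cong) auto
  then show "vec_sum n f r $ a = (if i < r then f i else 0\<^sub>v n) $ a"
    using a by (simp add: vec_sum_def)
qed (use assms(2) in auto)

section \<open>Stacked vectors and block matrices\<close>

lemma stack_vec_carrier [simp]: "stack_vec k r f \<in> carrier_vec (k * r)"
  by (simp add: stack_vec_def)

lemma dim_stack_vec [simp]: "dim_vec (stack_vec k r f) = k * r"
  by (simp add: stack_vec_def)

lemma div_less_of_less_mult: "i < k * (r::nat) \<Longrightarrow> i div k < r"
  by (simp add: less_mult_imp_div_less mult.commute)

lemma mod_less_of_less_mult: "i < k * (r::nat) \<Longrightarrow> i mod k < k"
  by (cases k) auto

lemmas block_index = div_less_of_less_mult mod_less_of_less_mult

lemma stack_vec_cong: "(\<And>i. i < r \<Longrightarrow> f i = h i) \<Longrightarrow> stack_vec k r f = stack_vec k r h"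
  by (auto simp: stack_vec_def div_less_of_less_mult)

lemma stack_vec_add:
  assumes "\<And>i. i < r \<Longrightarrow> f i \<in> carrier_vec k" "\<And>i. i < r \<Longrightarrow> h i \<in> carrier_vec k"
  shows "stack_vec k r f + stack_vec k r h = stack_vec k r (\<lambda>i. f i + h i)"
proof (rule eq_vecI)
  fix i assume "i < dim_vec (stack_vec k r (\<lambda>i. f i + h i))"
  then have i: "i < k * r" by simp
  have "f (i div k) \<in> carrier_vec k" "h (i div k) \<in> carrier_vec k"
    using assms block_index[OF i] by auto
  then show "(stack_vec k r f + stack_vec k r h) $ i = stack_vec k r (\<lambda>i. f i + h i) $ i"
    using i block_index[OF i] by (simp add: stack_vec_def)
qed simp

lemma stack_vec_one: "v \<in> carrier_vec k \<Longrightarrow> stack_vec k 1 (\<lambda>_. v) = v"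
  by (auto simp: stack_vec_def)

lemma block_mat_carrier [simp]: "block_mat nr nc r c F \<in> carrier_mat (nr * r) (nc * c)"
  by (simp add: block_mat_def)

lemma sum_by_blocks:
  fixes f :: "nat \<Rightarrow> real"
  shows "(\<Sum>t<k * c. f t) = (\<Sum>j<c. \<Sum>b<k. f (j * k + b))"
proof -
  have "(\<Sum>t<k * c. f t) = (\<Sum>j<c. \<Sum>t = j * k..<j * k + k. f t)"
    by (simp add: sum.nat_group mult.commute)
  also have "\<dots> = (\<Sum>j<c. \<Sum>b<k. f (j * k + b))"
  proof (rule sum.cong[OF refl])
    fix j
    show "(\<Sum>t = j * k..<j * k + k. f t) = (\<Sum>b<k. f (j * k + b))"
      using sum.shift_bounds_nat_ivl[of f 0 "j * k" k] by (simp add: atLeast0LessThan add.commute)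
  qed
  finally show ?thesis .
qed

lemma mult_mat_vec_index_sum:
  fixes M :: "real mat"
  assumes "M \<in> carrier_mat nr nc" "v \<in> carrier_vec nc" "a < nr"
  shows "(M *\<^sub>v v) $ a = (\<Sum>b<nc. M $$ (a, b) * v $ b)"
  using assms by (auto simp: scalar_prod_def atLeast0LessThan intro!: sum.cong)

text \<open>The entries of the product are sums over \<open>nc * c\<close> scalar columns; grouped into
  consecutive runs of length \<open>nc\<close>, they become the block products. The shift, last-block,
  observability, Toeplitz and reachability matrices are all evaluated through this lemma.\<close>

lemma block_mat_mult_stack_vec:
  assumes F: "\<And>i j. i < r \<Longrightarrow> j < c \<Longrightarrow> F i j \<in> carrier_mat nr nc"
    and v: "\<And>j. j < c \<Longrightarrow> v j \<in> carrier_vec nc"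
  shows "block_mat nr nc r c F *\<^sub>v stack_vec nc c v =
    stack_vec nr r (\<lambda>i. vec_sum nr (\<lambda>j. F i j *\<^sub>v v j) c)"
proof (rule eq_vecI)
  fix t assume "t < dim_vec (stack_vec nr r (\<lambda>i. vec_sum nr (\<lambda>j. F i j *\<^sub>v v j) c))"
  then have t: "t < nr * r" by simp
  let ?i = "t div nr" and ?a = "t mod nr"
  note ia = block_index[OF t]
  have "(block_mat nr nc r c F *\<^sub>v stack_vec nc c v) $ t =
      (\<Sum>s<nc * c. F ?i (s div nc) $$ (?a, s mod nc) * v (s div nc) $ (s mod nc))"
    by (subst mult_mat_vec_index_sum[OF block_mat_carrier stack_vec_carrier t])
      (use t in \<open>auto simp: block_mat_def stack_vec_def intro!: sum.cong\<close>)
  also have "\<dots> = (\<Sum>j<c. \<Sum>b<nc. F ?i j $$ (?a, b) * v j $ b)"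
    unfolding sum_by_blocks by (intro sum.cong) auto
  also have "\<dots> = (\<Sum>j<c. (F ?i j *\<^sub>v v j) $ ?a)"
    using F v ia by (intro sum.cong refl mult_mat_vec_index_sum[symmetric]) auto
  also have "\<dots> = stack_vec nr r (\<lambda>i. vec_sum nr (\<lambda>j. F i j *\<^sub>v v j) c) $ t"
    using t ia by (simp add: stack_vec_def vec_sum_def)
  finally show "(block_mat nr nc r c F *\<^sub>v stack_vec nc c v) $ t =
    stack_vec nr r (\<lambda>i. vec_sum nr (\<lambda>j. F i j *\<^sub>v v j) c) $ t" .
qed (simp add: block_mat_def)

lemma block_column_mult_vec:
  assumes F: "\<And>i. i < r \<Longrightarrow> F i \<in> carrier_mat nr nc" and v: "v \<in> carrier_vec nc"
  shows "block_mat nr nc r 1 (\<lambda>i _. F i) *\<^sub>v v = stack_vec nr r (\<lambda>i. F i *\<^sub>v v)"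
proof -
  have "block_mat nr nc r 1 (\<lambda>i _. F i) *\<^sub>v v =
      block_mat nr nc r 1 (\<lambda>i _. F i) *\<^sub>v stack_vec nc 1 (\<lambda>_. v)"
    using v by (simp add: stack_vec_one del: One_nat_def)
  also have "\<dots> = stack_vec nr r (\<lambda>i. vec_sum nr (\<lambda>j. F i *\<^sub>v v) 1)"
    using F v by (subst block_mat_mult_stack_vec) auto
  also have "\<dots> = stack_vec nr r (\<lambda>i. F i *\<^sub>v v)"
  proof (rule stack_vec_cong)
    fix i assume "i < r"
    then have "F i *\<^sub>v v \<in> carrier_vec nr" using mult_mat_vec_carrier[OF F v] by simp
    then show "vec_sum nr (\<lambda>j. F i *\<^sub>v v) 1 = F i *\<^sub>v v"
      using vec_sum_single[of 1 0 "\<lambda>_. F i *\<^sub>v v" nr] by simp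
  qed
  finally show ?thesis .
qed

lemma last_block_carrier [simp]: "last_block k r \<in> carrier_mat (k * r) k"
  using block_mat_carrier[of k k r 1] by (simp add: last_block_def)

lemma last_block_mult_vec:
  assumes "v \<in> carrier_vec k"
  shows "last_block k r *\<^sub>v v = stack_vec k r (\<lambda>i. if Suc i = r then v else 0\<^sub>v k)"
  unfolding last_block_def using assms
  by (subst block_column_mult_vec) (auto intro!: stack_vec_cong eq_vecI)

lemma shift_mat_carrier [simp]: "shift_mat k r \<in> carrier_mat (k * r) (k * r)"
  by (simp add: shift_mat_def)

lemma shift_mat_mult_stack_vec:
  assumes v: "\<And>i. i < r \<Longrightarrow> v i \<in> carrier_vec k"
  shows "shift_mat k r *\<^sub>v stack_vec k r v =
    stack_vec k r (\<lambda>i. if Suc i < r then v (Suc i) else 0\<^sub>v k)"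
proof -
  have "shift_mat k r *\<^sub>v stack_vec k r v = stack_vec k r (\<lambda>i. vec_sum k
      (\<lambda>j. (if j = Suc i then 1\<^sub>m k else 0\<^sub>m k k) *\<^sub>v v j) r)"
    unfolding shift_mat_def using v by (subst block_mat_mult_stack_vec) auto
  also have "\<dots> = stack_vec k r (\<lambda>i. if Suc i < r then v (Suc i) else 0\<^sub>v k)"
  proof (rule stack_vec_cong)
    fix i assume "i < r"
    show "vec_sum k (\<lambda>j. (if j = Suc i then 1\<^sub>m k else 0\<^sub>m k k) *\<^sub>v v j) r =
      (if Suc i < r then v (Suc i) else 0\<^sub>v k)"
      using v by (subst vec_sum_single[where i = "Suc i"]) auto
  qed
  finally show ?thesis .
qed

text \<open>The register update: the shift leaves the last block zero, and \<open>last_block\<close> puts the newest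
  sample \<open>v r\<close> there.\<close>

lemma shift_and_append:
  assumes v: "\<And>i. i \<le> r \<Longrightarrow> v i \<in> carrier_vec k"
  shows "shift_mat k r *\<^sub>v stack_vec k r v + last_block k r *\<^sub>v v r =
    stack_vec k r (\<lambda>i. v (Suc i))"
proof -
  have "shift_mat k r *\<^sub>v stack_vec k r v + last_block k r *\<^sub>v v r =
     stack_vec k r (\<lambda>i. (if Suc i < r then v (Suc i) else 0\<^sub>v k) +
       (if Suc i = r then v r else 0\<^sub>v k))"
    using v by (simp add: shift_mat_mult_stack_vec last_block_mult_vec stack_vec_add)
  also have "\<dots> = stack_vec k r (\<lambda>i. v (Suc i))"
  proof (rule stack_vec_cong)
    fix i assume "i < r"
    then show "(if Suc i < r then v (Suc i) else 0\<^sub>v k) + (if Suc i = r then v r else 0\<^sub>v k)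
       = v (Suc i)"
      using v[of "Suc i"] by (cases "Suc i = r") auto
  qed
  finally show ?thesis .
qed

section \<open>Predicting the next output without a disturbance\<close>

lemma Ru_mat_carrier [simp]:
  "A \<in> carrier_mat n n \<Longrightarrow> B \<in> carrier_mat n m \<Longrightarrow> Ru_mat A B l \<in> carrier_mat n (m * l)"
  using block_mat_carrier[of n m 1 l] by (auto simp: Ru_mat_def)

lemma Tu_mat_carrier [simp]:
  "C \<in> carrier_mat p n \<Longrightarrow> B \<in> carrier_mat n m \<Longrightarrow> Tu_mat A B C l \<in> carrier_mat (p * l) (m * l)"
  by (auto simp: Tu_mat_def)

lemma obsv_mat_carrier [simp]:
  "C \<in> carrier_mat p n \<Longrightarrow> A \<in> carrier_mat n n \<Longrightarrow> obsv_mat A C l \<in> carrier_mat (p * l) n"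
  using block_mat_carrier[of p n l 1] by (auto simp: obsv_mat_def)

lemma Ru_mat_mult_stack_vec:
  assumes A: "A \<in> carrier_mat n n" and B: "B \<in> carrier_mat n m"
    and u: "\<And>j. j < l \<Longrightarrow> u j \<in> carrier_vec m"
  shows "Ru_mat A B l *\<^sub>v stack_vec m l u =
    vec_sum n (\<lambda>j. A ^\<^sub>m (l - 1 - j) * B *\<^sub>v u j) l"
proof -
  have "A ^\<^sub>m k * B \<in> carrier_mat n m" for k
    by (rule mult_carrier_mat[OF pow_carrier_mat[OF A] B])
  then show ?thesis
    using A B u block_mat_mult_stack_vec[of 1 l "\<lambda>_ j. A ^\<^sub>m (l - 1 - j) * B" n m u]
    by (simp add: Ru_mat_def stack_vec_one del: One_nat_def)
qed

text \<open>Variation of constants. The induction needs \<open>Ru_mat A B (i + 1)\<close> applied to the longer input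
  to be \<open>A\<close> times the previous product plus \<open>B u i\<close>, which is visible once the product is written
  as a sum of vectors.\<close>

lemma state_response:
  assumes A: "A \<in> carrier_mat n n" and B: "B \<in> carrier_mat n m"
    and x0: "x 0 \<in> carrier_vec n"
    and u: "\<And>j. j < i \<Longrightarrow> u j \<in> carrier_vec m"
    and step: "\<And>j. j < i \<Longrightarrow> x (Suc j) = A *\<^sub>v x j + B *\<^sub>v u j"
  shows "x i = A ^\<^sub>m i *\<^sub>v x 0 + Ru_mat A B i *\<^sub>v stack_vec m i u"
proof -
  have pow: "A ^\<^sub>m k \<in> carrier_mat n n" for k using A by simp
  have "x i = A ^\<^sub>m i *\<^sub>v x 0 + vec_sum n (\<lambda>j. A ^\<^sub>m (i - 1 - j) * B *\<^sub>v u j) i"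
    using u step
  proof (induction i)
    case 0
    have "vec_sum n f 0 = 0\<^sub>v n" for f by (auto simp: vec_sum_def)
    with A x0 show ?case by simp
  next
    case (Suc i)
    let ?f = "\<lambda>j. A ^\<^sub>m (i - 1 - j) * B *\<^sub>v u j"
    have AA: "A *\<^sub>v (A ^\<^sub>m k *\<^sub>v v) = A ^\<^sub>m Suc k *\<^sub>v v" if "v \<in> carrier_vec n" for k v
    proof -
      have "A ^\<^sub>m Suc k = A * A ^\<^sub>m k" 
        using A by (induction k) (auto simp: assoc_mult_mat[of _ n n _ n _ n])
      then show ?thesis using A pow that by (simp add: assoc_mult_mat_vec[of _ n n _ n] del: pow_mat.simps)
    qed
    have f: "?f j \<in> carrier_vec n" if "j < i" for j
      using that Suc.prems(1)[of j] by (intro mult_mat_vec_carrier[OF mult_carrier_mat[OF pow B]]) simp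
    have "A *\<^sub>v vec_sum n ?f i = vec_sum n (\<lambda>j. A ^\<^sub>m (Suc i - 1 - j) * B *\<^sub>v u j) i"
    proof (subst mult_mat_vec_sum[OF A f], assumption, rule vec_sum_cong)
      fix j assume j: "j < i"
      then have uj: "u j \<in> carrier_vec m" and k: "Suc (i - 1 - j) = Suc i - 1 - j"
        using Suc.prems(1)[of j] by auto
      show "A *\<^sub>v ?f j = A ^\<^sub>m (Suc i - 1 - j) * B *\<^sub>v u j"
        using AA[of "B *\<^sub>v u j" "i - 1 - j"] uj B pow unfolding k
        by (simp add: assoc_mult_mat_vec[of _ n n _ m])
    qed
    moreover have "B *\<^sub>v u i = A ^\<^sub>m (Suc i - 1 - i) * B *\<^sub>v u i"
      using A B by simp
    moreover have "B *\<^sub>v u i \<in> carrier_vec n" using B Suc.prems(1)[of i] by auto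
    moreover have "x (Suc i) = A *\<^sub>v (A ^\<^sub>m i *\<^sub>v x 0 + vec_sum n ?f i) + B *\<^sub>v u i"
      using Suc by simp
    moreover have "A *\<^sub>v (A ^\<^sub>m i *\<^sub>v x 0 + vec_sum n ?f i) = A ^\<^sub>m Suc i *\<^sub>v x 0 + A *\<^sub>v vec_sum n ?f i"
      by (simp only: AA[OF x0] mult_add_distrib_mat_vec[OF A mult_mat_vec_carrier[OF pow x0]
            vec_sum_carrier])
    ultimately show ?case
      using assoc_add_vec[OF mult_mat_vec_carrier[OF pow x0, of "Suc i"] vec_sum_carrier]
      by (simp add: vec_sum_Suc del: pow_mat.simps)
  qed
  then show ?thesis using Ru_mat_mult_stack_vec[OF A B u] by simp
qed


lemma vec_sum_truncate:
  assumes "i \<le> r" "\<And>j. i \<le> j \<Longrightarrow> j < r \<Longrightarrow> f j = 0\<^sub>v n"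
  shows "vec_sum n f r = vec_sum n f i"
proof -
  have "(\<Sum>j<r. f j $ a) = (\<Sum>j<i. f j $ a)" if "a < n" for a
    by (rule sum.mono_neutral_right) (use assms that in auto)
  then show ?thesis by (auto simp: vec_sum_def)
qed

text \<open>Block row \<open>i\<close> of \<open>Tu_mat\<close> is \<open>C\<close> times \<open>Ru_mat A B i\<close>, padded with zero blocks, so this is
  \<open>C\<close> applied to the state response at each time of the window.\<close>

lemma output_response:
  assumes A: "A \<in> carrier_mat n n" and B: "B \<in> carrier_mat n m" and C: "C \<in> carrier_mat p n"
    and x0: "x 0 \<in> carrier_vec n"
    and u: "\<And>j. j < l \<Longrightarrow> u j \<in> carrier_vec m"
    and step: "\<And>j. j < l \<Longrightarrow> x (Suc j) = A *\<^sub>v x j + B *\<^sub>v u j"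
  shows "stack_vec p l (\<lambda>i. C *\<^sub>v x i) =
    obsv_mat A C l *\<^sub>v x 0 + Tu_mat A B C l *\<^sub>v stack_vec m l u"
proof -
  have pow: "A ^\<^sub>m k \<in> carrier_mat n n" for k using A by simp
  have powB: "A ^\<^sub>m k * B \<in> carrier_mat n m" for k
    by (rule mult_carrier_mat[OF pow B])
  have CpowB: "C * A ^\<^sub>m k * B \<in> carrier_mat p m" for k
    by (rule mult_carrier_mat[OF mult_carrier_mat[OF C pow] B])
  let ?F = "\<lambda>i j. if j < i then C * A ^\<^sub>m (i - j - 1) * B else 0\<^sub>m p m"
  let ?R = "\<lambda>i. Ru_mat A B i *\<^sub>v stack_vec m i u"
  have R: "?R i \<in> carrier_vec n" for i
    by (rule mult_mat_vec_carrier[OF Ru_mat_carrier[OF A B] stack_vec_carrier])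
  have blockrow: "vec_sum p (\<lambda>j. ?F i j *\<^sub>v u j) l = C *\<^sub>v ?R i" if i: "i < l" for i
  proof -
    have "vec_sum p (\<lambda>j. ?F i j *\<^sub>v u j) l = vec_sum p (\<lambda>j. ?F i j *\<^sub>v u j) i"
      using i u by (intro vec_sum_truncate) auto
    also have "\<dots> = vec_sum p (\<lambda>j. C *\<^sub>v (A ^\<^sub>m (i - 1 - j) * B *\<^sub>v u j)) i"
    proof (rule vec_sum_cong)
      fix j assume j: "j < i"
      have "i - j - 1 = i - 1 - j" by simp
      then show "?F i j *\<^sub>v u j = C *\<^sub>v (A ^\<^sub>m (i - 1 - j) * B *\<^sub>v u j)"
        using j i u[of j] assoc_mult_mat[OF C pow B]
          assoc_mult_mat_vec[OF C powB, of "u j"] by simp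
    qed
    also have "\<dots> = C *\<^sub>v vec_sum n (\<lambda>j. A ^\<^sub>m (i - 1 - j) * B *\<^sub>v u j) i"
    proof (rule mult_mat_vec_sum[OF C, symmetric])
      fix j assume "j < i"
      with i u[of j] show "A ^\<^sub>m (i - 1 - j) * B *\<^sub>v u j \<in> carrier_vec n"
        by (intro mult_mat_vec_carrier[OF powB]) simp
    qed
    also have "\<dots> = C *\<^sub>v ?R i"
      using Ru_mat_mult_stack_vec[OF A B, of i u] u i by simp
    finally show ?thesis .
  qed
  have "Tu_mat A B C l *\<^sub>v stack_vec m l u = stack_vec p l (\<lambda>i. vec_sum p (\<lambda>j. ?F i j *\<^sub>v u j) l)"
    unfolding Tu_mat_def carrier_matD(1)[OF C] carrier_matD(2)[OF B]
    by (rule block_mat_mult_stack_vec) (simp_all add: CpowB u)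
  also have "\<dots> = stack_vec p l (\<lambda>i. C *\<^sub>v ?R i)"
    by (rule stack_vec_cong) (rule blockrow)
  finally have Tu: "Tu_mat A B C l *\<^sub>v stack_vec m l u = stack_vec p l (\<lambda>i. C *\<^sub>v ?R i)" .
  have "obsv_mat A C l *\<^sub>v x 0 = stack_vec p l (\<lambda>i. C * A ^\<^sub>m i *\<^sub>v x 0)"
    using block_column_mult_vec[of l "\<lambda>i. C * A ^\<^sub>m i" p n "x 0"] mult_carrier_mat[OF C pow] x0 A C
    by (simp add: obsv_mat_def)
  then have "obsv_mat A C l *\<^sub>v x 0 + Tu_mat A B C l *\<^sub>v stack_vec m l u =
      stack_vec p l (\<lambda>i. C * A ^\<^sub>m i *\<^sub>v x 0 + C *\<^sub>v ?R i)"
    unfolding Tu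
    using mult_mat_vec_carrier[OF mult_carrier_mat[OF C pow] x0] mult_mat_vec_carrier[OF C R]
    by (simp add: stack_vec_add)
  also have "\<dots> = stack_vec p l (\<lambda>i. C *\<^sub>v x i)"
  proof (rule stack_vec_cong)
    fix i assume i: "i < l"
    have "x i = A ^\<^sub>m i *\<^sub>v x 0 + ?R i"
      using i u step by (intro state_response[where x = x and u = u, OF A B x0]) auto
    then show "C * A ^\<^sub>m i *\<^sub>v x 0 + C *\<^sub>v ?R i = C *\<^sub>v x i"
      by (simp only: assoc_mult_mat_vec[OF C pow x0]
          mult_add_distrib_mat_vec[OF C mult_mat_vec_carrier[OF pow x0] R])
  qed
  finally show ?thesis by simp
qed

text \<open>\<open>block_row\<close> is a four-block matrix with empty lower blocks, so its product with a vector
  carries an empty lower part that has to be dropped.\<close>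

lemma append_vec_dim_0: "dim_vec w = 0 \<Longrightarrow> v @\<^sub>v w = v"
  by (rule eq_vecI) auto

lemma append_vec_assoc: "(a @\<^sub>v b) @\<^sub>v c = a @\<^sub>v (b @\<^sub>v c)"
  by (rule eq_vecI) auto

lemma block_row_carrier:
  "M1 \<in> carrier_mat k c1 \<Longrightarrow> M2 \<in> carrier_mat k c2 \<Longrightarrow> block_row M1 M2 \<in> carrier_mat k (c1 + c2)"
  by (auto simp: block_row_def)

lemma block_row_mult_append_vec:
  assumes M: "M1 \<in> carrier_mat k c1" "M2 \<in> carrier_mat k c2"
    and v: "a \<in> carrier_vec c1" "b \<in> carrier_vec c2"
  shows "block_row M1 M2 *\<^sub>v (a @\<^sub>v b) = M1 *\<^sub>v a + M2 *\<^sub>v b"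
proof -
  have "0\<^sub>m 0 (dim_col M1) \<in> carrier_mat 0 c1" "0\<^sub>m 0 (dim_col M2) \<in> carrier_mat 0 c2"
    using M by auto
  from four_block_mat_mult_vec[OF M this v] show ?thesis
    by (simp add: block_row_def append_vec_dim_0)
qed

lemma Z1_mat_carrier:
  assumes A: "A \<in> carrier_mat n n" and B: "B \<in> carrier_mat n m" and C: "C \<in> carrier_mat p n"
    and OL: "OL \<in> carrier_mat n (p * l)"
  shows "Z1_mat A B C l OL \<in> carrier_mat p (p * l + m * l)"
  unfolding Z1_mat_def
proof (rule block_row_carrier)
  show 1: "C * A ^\<^sub>m l * OL \<in> carrier_mat p (p * l)"
    by (rule mult_carrier_mat[OF mult_carrier_mat[OF C pow_carrier_mat[OF A]] OL])
  show "C * Ru_mat A B l - C * A ^\<^sub>m l * OL * Tu_mat A B C l \<in> carrier_mat p (m * l)"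
    by (rule minus_carrier_mat[OF mult_carrier_mat[OF 1 Tu_mat_carrier[OF C B]]])
qed

text \<open>Since \<open>stack y = O x\<^sub>0 + Tu stack u\<close>, the left inverse recovers
  \<open>x\<^sub>0 = OL (stack y - Tu stack u)\<close>. Substituting this into the state response at time \<open>l\<close> and
  collecting the coefficients of \<open>y\<close> and of \<open>u\<close> gives the two blocks of \<open>Z1_mat\<close>.\<close>

lemma output_prediction:
  assumes A: "A \<in> carrier_mat n n" and B: "B \<in> carrier_mat n m" and C: "C \<in> carrier_mat p n"
    and OL: "OL \<in> carrier_mat n (p * l)" and left_inverse: "OL * obsv_mat A C l = 1\<^sub>m n"
    and x0: "x 0 \<in> carrier_vec n"
    and u: "\<And>j. j < l \<Longrightarrow> u j \<in> carrier_vec m"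
    and step: "\<And>j. j < l \<Longrightarrow> x (Suc j) = A *\<^sub>v x j + B *\<^sub>v u j"
  shows "Z1_mat A B C l OL *\<^sub>v (stack_vec p l (\<lambda>i. C *\<^sub>v x i) @\<^sub>v stack_vec m l u) = C *\<^sub>v x l"
proof -
  let ?U = "stack_vec m l u" and ?R = "Ru_mat A B l" and ?Tu = "Tu_mat A B C l"
    and ?K = "C * A ^\<^sub>m l" and ?O = "obsv_mat A C l"
  have U: "?U \<in> carrier_vec (m * l)" by simp
  have pow: "A ^\<^sub>m l \<in> carrier_mat n n" using A by simp
  have K: "?K \<in> carrier_mat p n" by (rule mult_carrier_mat[OF C pow])
  have KO: "?K * OL \<in> carrier_mat p (p * l)" by (rule mult_carrier_mat[OF K OL])
  have R: "?R \<in> carrier_mat n (m * l)" by (rule Ru_mat_carrier[OF A B])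
  have Tu: "?Tu \<in> carrier_mat (p * l) (m * l)" by (rule Tu_mat_carrier[OF C B])
  have O: "?O \<in> carrier_mat (p * l) n" by (rule obsv_mat_carrier[OF C A])
  have KT: "?K * OL * ?Tu \<in> carrier_mat p (m * l)" by (rule mult_carrier_mat[OF KO Tu])
  have CR: "C * ?R \<in> carrier_mat p (m * l)" by (rule mult_carrier_mat[OF C R])
  have RU: "?R *\<^sub>v ?U \<in> carrier_vec n" by (rule mult_mat_vec_carrier[OF R U])
  have TuU: "?Tu *\<^sub>v ?U \<in> carrier_vec (p * l)" by (rule mult_mat_vec_carrier[OF Tu U])
  have Ox: "?O *\<^sub>v x 0 \<in> carrier_vec (p * l)" by (rule mult_mat_vec_carrier[OF O x0])
  have Y: "stack_vec p l (\<lambda>i. C *\<^sub>v x i) = ?O *\<^sub>v x 0 + ?Tu *\<^sub>v ?U"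
    by (rule output_response[where x = x and u = u, OF A B C x0 u step])
  have 1: "?K * OL *\<^sub>v (?O *\<^sub>v x 0 + ?Tu *\<^sub>v ?U) = ?K *\<^sub>v x 0 + ?K * OL * ?Tu *\<^sub>v ?U"
  proof -
    have "?K * OL *\<^sub>v (?O *\<^sub>v x 0) = ?K *\<^sub>v ((OL * ?O) *\<^sub>v x 0)"
      by (simp only: assoc_mult_mat_vec[OF K OL Ox] assoc_mult_mat_vec[OF OL O x0])
    then show ?thesis
      using x0 by (simp only: mult_add_distrib_mat_vec[OF KO Ox TuU] left_inverse
          assoc_mult_mat_vec[OF KO Tu U] one_mult_mat_vec)
  qed
  have 2: "(C * ?R - ?K * OL * ?Tu) *\<^sub>v ?U = C *\<^sub>v (?R *\<^sub>v ?U) - ?K * OL * ?Tu *\<^sub>v ?U"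
    by (simp only: minus_mult_distrib_mat_vec[OF CR KT U] assoc_mult_mat_vec[OF C R U])
  have cancel: "a + b + (c - b) = a + c"
    if "a \<in> carrier_vec p" "b \<in> carrier_vec p" "c \<in> carrier_vec p" for a b c :: "real vec"
    using that by (intro eq_vecI) auto
  have "Z1_mat A B C l OL *\<^sub>v (stack_vec p l (\<lambda>i. C *\<^sub>v x i) @\<^sub>v ?U) =
      ?K *\<^sub>v x 0 + C *\<^sub>v (?R *\<^sub>v ?U)"
    unfolding Z1_mat_def
    by (simp only: block_row_mult_append_vec[OF KO minus_carrier_mat[OF KT] add_carrier_vec[OF Ox TuU] U] Y 1 2
        cancel[OF mult_mat_vec_carrier[OF K x0] mult_mat_vec_carrier[OF KT U] mult_mat_vec_carrier[OF C RU]])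
  also have "\<dots> = C *\<^sub>v (A ^\<^sub>m l *\<^sub>v x 0 + ?R *\<^sub>v ?U)"
    by (simp only: assoc_mult_mat_vec[OF C pow x0]
        mult_add_distrib_mat_vec[OF C mult_mat_vec_carrier[OF pow x0] RU])
  also have "A ^\<^sub>m l *\<^sub>v x 0 + ?R *\<^sub>v ?U = x l"
    using state_response[where x = x and u = u and i = l, OF A B x0 u step] by simp
  finally show ?thesis .
qed

section \<open>One step of the lifted system\<close>

lemma im_Phi_carrier: "im_Phi p q \<in> carrier_mat (p * degree q) (p * degree q)"
  by (simp add: im_Phi_def Let_def)

lemma im_G_carrier: "im_G p q \<in> carrier_mat (p * degree q) p"
  by (simp add: im_G_def)

lemma zero_mult_mat_vec: "v \<in> carrier_vec c \<Longrightarrow> 0\<^sub>m r c *\<^sub>v v = 0\<^sub>v r" for v :: "real vec"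
  by (intro eq_vecI) auto

lemma bA_mat_carrier:
  assumes "Z \<in> carrier_mat p (p * l + m * l)"
  shows "bA_mat p m l Z \<in> carrier_mat (p * l + m * l) (p * l + m * l)"
proof -
  have "bL_mat p m l \<in> carrier_mat (p * l + m * l) p"
    unfolding bL_mat_def by (intro carrier_append_rows) auto
  with assms have "bL_mat p m l * Z \<in> carrier_mat (p * l + m * l) (p * l + m * l)"
    by (intro mult_carrier_mat)
  then show ?thesis unfolding bA_mat_def by simp
qed

lemma bB_mat_carrier: "bB_mat p m l \<in> carrier_mat (p * l + m * l) m"
  unfolding bB_mat_def by (intro carrier_append_rows) auto

lemma Abar_mat_carrier:
  assumes "Z \<in> carrier_mat p (p * l + m * l)"
  shows "Abar_mat p m l q Z \<in>
    carrier_mat (p * l + m * l + p * degree q) (p * l + m * l + p * degree q)"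
  unfolding Abar_mat_def
  by (rule four_block_carrier_mat[OF bA_mat_carrier[OF assms] im_Phi_carrier])

lemma Bbar_mat_carrier: "Bbar_mat p m l q \<in> carrier_mat (p * l + m * l + p * degree q) m"
  unfolding Bbar_mat_def by (intro carrier_append_rows bB_mat_carrier) auto

text \<open>The prediction \<open>Z\<close> enters \<open>Abar_mat\<close> twice: as the newest sample of the output register
  and as the input of the internal model. Once it equals \<open>y l\<close> on the given window, the step is
  only a shift of both registers and one step of the internal model.\<close>

lemma lifted_step:
  assumes Z: "Z \<in> carrier_mat p (p * l + m * l)"
    and y: "\<And>i. i \<le> l \<Longrightarrow> y i \<in> carrier_vec p"
    and u: "\<And>i. i \<le> l \<Longrightarrow> u i \<in> carrier_vec m"
    and h: "h \<in> carrier_vec (p * degree q)"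
    and pred: "Z *\<^sub>v (stack_vec p l y @\<^sub>v stack_vec m l u) = y l"
  shows "Abar_mat p m l q Z *\<^sub>v (stack_vec p l y @\<^sub>v stack_vec m l u @\<^sub>v h) +
      Bbar_mat p m l q *\<^sub>v u l =
    stack_vec p l (\<lambda>i. y (Suc i)) @\<^sub>v stack_vec m l (\<lambda>i. u (Suc i)) @\<^sub>v
      (im_Phi p q *\<^sub>v h + im_G p q *\<^sub>v y l)"
proof -
  let ?Y = "stack_vec p l y" and ?U = "stack_vec m l u" and ?d = "p * degree q"
  let ?sY = "shift_mat p l *\<^sub>v ?Y" and ?sU = "shift_mat m l *\<^sub>v ?U"
  let ?eY = "last_block p l *\<^sub>v y l" and ?eU = "last_block m l *\<^sub>v u l"
  have yl: "y l \<in> carrier_vec p" and ul: "u l \<in> carrier_vec m" using y u by auto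
  have YU: "?Y @\<^sub>v ?U \<in> carrier_vec (p * l + m * l)" by simp
  have cs: "?sY \<in> carrier_vec (p * l)" "?sU \<in> carrier_vec (m * l)"
    by (rule mult_mat_vec_carrier[OF shift_mat_carrier stack_vec_carrier])+
  have ce: "?eY \<in> carrier_vec (p * l)" "?eU \<in> carrier_vec (m * l)"
    by (rule mult_mat_vec_carrier[OF last_block_carrier yl],
        rule mult_mat_vec_carrier[OF last_block_carrier ul])
  have L: "bL_mat p m l \<in> carrier_mat (p * l + m * l) p"
    unfolding bL_mat_def by (intro carrier_append_rows) auto
  have F: "bF_mat p m l \<in> carrier_mat (p * l + m * l) (p * l + m * l)"
    unfolding bF_mat_def by (intro four_block_carrier_mat) auto
  have Fv: "bF_mat p m l *\<^sub>v (?Y @\<^sub>v ?U) = ?sY @\<^sub>v ?sU"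
    unfolding bF_mat_def by (rule mult_mat_vec_split) auto
  have Lv: "bL_mat p m l *\<^sub>v y l = ?eY @\<^sub>v 0\<^sub>v (m * l)"
    unfolding bL_mat_def
    using mat_mult_append[OF last_block_carrier zero_carrier_mat yl, of l "m * l"] yl
    by (simp add: zero_mult_mat_vec)
  have bA: "bA_mat p m l Z *\<^sub>v (?Y @\<^sub>v ?U) = (?sY + ?eY) @\<^sub>v ?sU"
  proof -
    have "bA_mat p m l Z *\<^sub>v (?Y @\<^sub>v ?U) = (?sY @\<^sub>v ?sU) + (?eY @\<^sub>v 0\<^sub>v (m * l))"
      unfolding bA_mat_def
      by (simp only: add_mult_distrib_mat_vec[OF F mult_carrier_mat[OF L Z] YU]
          assoc_mult_mat_vec[OF L Z YU] pred Fv Lv)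
    also have "\<dots> = (?sY + ?eY) @\<^sub>v (?sU + 0\<^sub>v (m * l))"
      by (rule append_vec_add[OF cs(1) ce(1) cs(2)]) simp
    finally show ?thesis using cs by simp
  qed
  let ?h' = "im_Phi p q *\<^sub>v h + im_G p q *\<^sub>v y l"
  have Gy: "im_G p q *\<^sub>v y l \<in> carrier_vec ?d" by (rule mult_mat_vec_carrier[OF im_G_carrier yl])
  have Ph: "im_Phi p q *\<^sub>v h \<in> carrier_vec ?d" by (rule mult_mat_vec_carrier[OF im_Phi_carrier h])
  have "Abar_mat p m l q Z *\<^sub>v ((?Y @\<^sub>v ?U) @\<^sub>v h) =
      (bA_mat p m l Z *\<^sub>v (?Y @\<^sub>v ?U) + 0\<^sub>m ((p + m) * l) ?d *\<^sub>v h) @\<^sub>v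
      (im_G p q * Z *\<^sub>v (?Y @\<^sub>v ?U) + im_Phi p q *\<^sub>v h)"
    unfolding Abar_mat_def
    by (rule four_block_mat_mult_vec[OF bA_mat_carrier[OF Z] _
          mult_carrier_mat[OF im_G_carrier Z] im_Phi_carrier YU h]) (simp add: distrib_right)
  also have "\<dots> = ((?sY + ?eY) @\<^sub>v ?sU) @\<^sub>v ?h'"
    using cs ce
    by (simp add: bA zero_mult_mat_vec[OF h] assoc_mult_mat_vec[OF im_G_carrier Z YU] pred
        comm_add_vec[OF Gy Ph] distrib_right)
  finally have Abar: "Abar_mat p m l q Z *\<^sub>v ((?Y @\<^sub>v ?U) @\<^sub>v h) = ((?sY + ?eY) @\<^sub>v ?sU) @\<^sub>v ?h'" .
  have "Bbar_mat p m l q *\<^sub>v u l = bB_mat p m l *\<^sub>v u l @\<^sub>v 0\<^sub>m ?d m *\<^sub>v u l"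
    unfolding Bbar_mat_def by (rule mat_mult_append[OF bB_mat_carrier zero_carrier_mat ul])
  also have "bB_mat p m l *\<^sub>v u l = 0\<^sub>m (p * l) m *\<^sub>v u l @\<^sub>v ?eU"
    unfolding bB_mat_def by (rule mat_mult_append[OF zero_carrier_mat last_block_carrier ul])
  finally have Bbar: "Bbar_mat p m l q *\<^sub>v u l = (0\<^sub>v (p * l) @\<^sub>v ?eU) @\<^sub>v 0\<^sub>v ?d"
    by (simp only: zero_mult_mat_vec[OF ul])
  have "Abar_mat p m l q Z *\<^sub>v ((?Y @\<^sub>v ?U) @\<^sub>v h) + Bbar_mat p m l q *\<^sub>v u l =
      (((?sY + ?eY) @\<^sub>v ?sU) + (0\<^sub>v (p * l) @\<^sub>v ?eU)) @\<^sub>v (?h' + 0\<^sub>v ?d)"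
    unfolding Abar Bbar using cs ce Gy Ph
    by (intro append_vec_add[of _ "p * l + m * l" _ _ ?d]) auto
  also have "((?sY + ?eY) @\<^sub>v ?sU) + (0\<^sub>v (p * l) @\<^sub>v ?eU) = (?sY + ?eY + 0\<^sub>v (p * l)) @\<^sub>v (?sU + ?eU)"
    using cs ce by (intro append_vec_add[of _ "p * l" _ _ "m * l"]) auto
  also have "?sY + ?eY + 0\<^sub>v (p * l) = stack_vec p l (\<lambda>i. y (Suc i))"
    using shift_and_append[of l y p, OF y] by simp
  also have "?sU + ?eU = stack_vec m l (\<lambda>i. u (Suc i))"
    using shift_and_append[of l u m, OF u] by simp
  also have "?h' + 0\<^sub>v ?d = ?h'" using Gy Ph by simp
  finally show ?thesis by (simp only: append_vec_assoc)
qed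

section \<open>Superposition of data windows\<close>

text \<open>The sequence \<open>superposition k g v\<close> is the weighted sum of the time-shifted copies of \<open>v\<close>,
  the copy shifted by \<open>c\<close> having the weight \<open>g $ c\<close>. Its argument \<open>a\<close> is a position in the
  window. A superposition of the solutions of a linear recursion is again a solution.\<close>

definition superposition :: "nat \<Rightarrow> real vec \<Rightarrow> (nat \<Rightarrow> real vec) \<Rightarrow> nat \<Rightarrow> real vec" where
  "superposition k g v a = vec_sum k (\<lambda>c. g $ c \<cdot>\<^sub>v v (a + c)) (dim_vec g)"

lemma superposition_carrier [simp]: "superposition k g v a \<in> carrier_vec k"
  by (simp add: superposition_def)

lemma dim_superposition [simp]: "dim_vec (superposition k g v a) = k"
  by (simp add: superposition_def)

lemma data_mat_carrier: "data_mat k v a b \<in> carrier_mat k (Suc b - a)"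
  by (rule carrier_matI) (simp_all add: data_mat_def del: upt_Suc)

lemma superposition_index:
  assumes "\<And>c. c < dim_vec g \<Longrightarrow> v (a + c) \<in> carrier_vec k" "i < k"
  shows "superposition k g v a $ i = (\<Sum>c<dim_vec g. g $ c * v (a + c) $ i)"
proof -
  have "(g $ c \<cdot>\<^sub>v v (a + c)) $ i = g $ c * v (a + c) $ i" if "c < dim_vec g" for c
    using assms(1)[OF that] assms(2) by simp
  then show ?thesis using assms(2) by (simp add: superposition_def vec_sum_def)
qed

text \<open>The columns of a data matrix are the shifted copies at one window position, so multiplying
  it by \<open>g\<close> evaluates the superposition there.\<close>

lemma data_mat_mult_vec:
  assumes g: "dim_vec g = Suc b - a"
    and v: "\<And>c. c < dim_vec g \<Longrightarrow> v (a + c) \<in> carrier_vec k"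
  shows "data_mat k v a b *\<^sub>v g = superposition k g v a"
proof (rule eq_vecI)
  fix i assume "i < dim_vec (superposition k g v a)"
  then have i: "i < k" by simp
  have "(data_mat k v a b *\<^sub>v g) $ i = (\<Sum>c<dim_vec g. data_mat k v a b $$ (i, c) * g $ c)"
    using data_mat_carrier[of k v a b]
    by (intro mult_mat_vec_index_sum[OF _ _ i]) (simp_all only: g carrier_vec_dim_vec carrier_vecI)
  also have "\<dots> = (\<Sum>c<dim_vec g. g $ c * v (a + c) $ i)"
    using g i by (intro sum.cong) (auto simp: data_mat_def mat_of_cols_index simp del: upt_Suc)
  finally show "(data_mat k v a b *\<^sub>v g) $ i = superposition k g v a $ i"
    by (simp add: superposition_index[of g v a k, OF v i])
qed (simp add: data_mat_def)

lemma superposition_cong: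
  "(\<And>c. c < dim_vec g \<Longrightarrow> v (a + c) = v' (a' + c)) \<Longrightarrow> superposition k g v a = superposition k g v' a'"
  unfolding superposition_def by (rule vec_sum_cong) simp

lemma mult_mat_superposition:
  assumes M: "M \<in> carrier_mat r k" and v: "\<And>c. c < dim_vec g \<Longrightarrow> v (a + c) \<in> carrier_vec k"
  shows "superposition r g (\<lambda>t. M *\<^sub>v v t) a = M *\<^sub>v superposition k g v a"
proof -
  have "M *\<^sub>v superposition k g v a = vec_sum r (\<lambda>c. M *\<^sub>v (g $ c \<cdot>\<^sub>v v (a + c))) (dim_vec g)"
    unfolding superposition_def using v by (intro mult_mat_vec_sum[OF M]) simp
  also have "\<dots> = superposition r g (\<lambda>t. M *\<^sub>v v t) a"
    unfolding superposition_def using v by (intro vec_sum_cong mult_mat_vec[OF M])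
  finally show ?thesis by simp
qed

lemma superposition_add:
  assumes "\<And>c. c < dim_vec g \<Longrightarrow> v (a + c) \<in> carrier_vec k"
    and "\<And>c. c < dim_vec g \<Longrightarrow> v' (a + c) \<in> carrier_vec k"
  shows "superposition k g (\<lambda>t. v t + v' t) a = superposition k g v a + superposition k g v' a"
proof -
  have "superposition k g (\<lambda>t. v t + v' t) a =
      vec_sum k (\<lambda>c. g $ c \<cdot>\<^sub>v v (a + c) + g $ c \<cdot>\<^sub>v v' (a + c)) (dim_vec g)"
    unfolding superposition_def using assms by (intro vec_sum_cong smult_add_distrib_vec)
  also have "\<dots> = superposition k g v a + superposition k g v' a"
    unfolding superposition_def using assms by (intro vec_sum_add) simp_all
  finally show ?thesis .
qed

text \<open>The next two lemmas show that the superposition of the vectors \<open>\<psi>\<close> is the \<open>\<psi>\<close> of the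
  superposed trajectory.\<close>

lemma superposition_append:
  assumes v: "\<And>c. c < dim_vec g \<Longrightarrow> v (a + c) \<in> carrier_vec k"
    and v': "\<And>c. c < dim_vec g \<Longrightarrow> v' (a + c) \<in> carrier_vec k'"
  shows "superposition (k + k') g (\<lambda>t. v t @\<^sub>v v' t) a = superposition k g v a @\<^sub>v superposition k' g v' a"
proof (rule eq_vecI)
  fix i assume "i < dim_vec (superposition k g v a @\<^sub>v superposition k' g v' a)"
  then have i: "i < k + k'" by simp
  have vv: "v (a + c) @\<^sub>v v' (a + c) \<in> carrier_vec (k + k')" if "c < dim_vec g" for c
    using v[OF that] v'[OF that] by simp
  have "superposition (k + k') g (\<lambda>t. v t @\<^sub>v v' t) a $ i =
      (\<Sum>c<dim_vec g. g $ c * (v (a + c) @\<^sub>v v' (a + c)) $ i)"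
    by (rule superposition_index[where v = "\<lambda>t. v t @\<^sub>v v' t", OF vv i])
  also have "\<dots> = (\<Sum>c<dim_vec g. g $ c * (if i < k then v (a + c) $ i else v' (a + c) $ (i - k)))"
  proof (intro sum.cong refl)
    fix c assume "c \<in> {..<dim_vec g}"
    then have "dim_vec (v (a + c)) = k" "dim_vec (v' (a + c)) = k'" using v[of c] v'[of c] by auto
    then show "g $ c * (v (a + c) @\<^sub>v v' (a + c)) $ i =
        g $ c * (if i < k then v (a + c) $ i else v' (a + c) $ (i - k))" using i by simp
  qed
  also have "\<dots> = (superposition k g v a @\<^sub>v superposition k' g v' a) $ i"
    using i by (auto simp: superposition_index[of g v a k, OF v] superposition_index[of g v' a k', OF v'])
  finally show "superposition (k + k') g (\<lambda>t. v t @\<^sub>v v' t) a $ i =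
    (superposition k g v a @\<^sub>v superposition k' g v' a) $ i" .
qed simp

lemma superposition_stack:
  assumes v: "\<And>i c. i < r \<Longrightarrow> c < dim_vec g \<Longrightarrow> v i (a + c) \<in> carrier_vec k"
  shows "superposition (k * r) g (\<lambda>t. stack_vec k r (\<lambda>i. v i t)) a =
    stack_vec k r (\<lambda>i. superposition k g (v i) a)"
proof (rule eq_vecI)
  fix s assume "s < dim_vec (stack_vec k r (\<lambda>i. superposition k g (v i) a))"
  then have s: "s < k * r" by simp
  note ia = block_index[OF s]
  have "superposition (k * r) g (\<lambda>t. stack_vec k r (\<lambda>i. v i t)) a $ s =
      (\<Sum>c<dim_vec g. g $ c * stack_vec k r (\<lambda>i. v i (a + c)) $ s)"
    by (rule superposition_index[where v = "\<lambda>t. stack_vec k r (\<lambda>i. v i t)", OF _ s]) simp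
  also have "\<dots> = (\<Sum>c<dim_vec g. g $ c * v (s div k) (a + c) $ (s mod k))"
    using s by (simp add: stack_vec_def)
  also have "\<dots> = superposition k g (v (s div k)) a $ (s mod k)"
    by (rule superposition_index[where v = "v (s div k)", symmetric, OF v[OF ia(1)] ia(2)])
  finally show "superposition (k * r) g (\<lambda>t. stack_vec k r (\<lambda>i. v i t)) a $ s =
      stack_vec k r (\<lambda>i. superposition k g (v i) a) $ s"
    using s by (simp add: stack_vec_def)
qed simp

section \<open>Superpositions free of the disturbance\<close>

text \<open>A nonzero real vector in the kernel would be a complex eigenvector for the eigenvalue
  \<open>0\<close>.\<close>

lemma no_zero_eigenvalue_imp_kernel_trivial:
  assumes S: "S \<in> carrier_mat k k"
    and eig: "\<not> eigenvalue (map_mat complex_of_real S) 0"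
    and v: "v \<in> carrier_vec k" "S *\<^sub>v v = 0\<^sub>v k"
  shows "v = 0\<^sub>v k"
proof (rule ccontr)
  assume "v \<noteq> 0\<^sub>v k"
  then obtain i where i: "i < k" "v $ i \<noteq> 0" using v(1) by (metis carrier_vecD eq_vecI index_zero_vec)
  let ?v = "map_vec complex_of_real v"
  have "map_mat complex_of_real S *\<^sub>v ?v = map_vec complex_of_real (S *\<^sub>v v)"
    by (rule of_real_hom.mult_mat_vec_hom[OF S v(1), symmetric])
  also have "\<dots> = 0 \<cdot>\<^sub>v ?v" unfolding v(2) using v(1) by (intro eq_vecI) auto
  finally have "map_mat complex_of_real S *\<^sub>v ?v = 0 \<cdot>\<^sub>v ?v" .
  moreover have "?v \<noteq> 0\<^sub>v k"
  proof
    assume "?v = 0\<^sub>v k"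
    then have "?v $ i = 0" using i by simp
    then show False using i v(1) by simp
  qed
  ultimately have "eigenvalue (map_mat complex_of_real S) 0"
    unfolding eigenvalue_def eigenvector_def using S v(1) by (intro exI[of _ ?v]) auto
  with eig show False by simp
qed


text \<open>The weights \<open>g\<close> annihilate the exosignal at the last position \<open>l\<close> of the window. Going
  backwards in time, injectivity of \<open>S\<close> makes the superposed exosignal zero in the whole window,
  and the superposed trajectory obeys the equations of the undisturbed plant, whose lifted step
  is known.\<close>

lemma lifted_step_superposition:
  fixes w x u y \<eta> :: "nat \<Rightarrow> real vec"
  assumes S: "S \<in> carrier_mat nw nw" and S_inj: "\<not> eigenvalue (map_mat complex_of_real S) 0"
    and A: "A \<in> carrier_mat n n" and B: "B \<in> carrier_mat n m" and P: "P \<in> carrier_mat n nw"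
    and C: "C \<in> carrier_mat p n" and Q: "Q \<in> carrier_mat p nw"
    and OL: "OL \<in> carrier_mat n (p * l)" "OL * obsv_mat A C l = 1\<^sub>m n"
    and T: "l \<le> T"
    and w: "\<And>k. k \<le> Suc T \<Longrightarrow> w k \<in> carrier_vec nw"
    and x: "\<And>k. k \<le> Suc T \<Longrightarrow> x k \<in> carrier_vec n"
    and u: "\<And>k. k \<le> T \<Longrightarrow> u k \<in> carrier_vec m"
    and \<eta>: "\<And>k. k \<le> Suc T \<Longrightarrow> \<eta> k \<in> carrier_vec (p * degree q)"
    and w_step: "\<And>k. k \<le> T \<Longrightarrow> w (Suc k) = S *\<^sub>v w k"
    and x_step: "\<And>k. k \<le> T \<Longrightarrow> x (Suc k) = A *\<^sub>v x k + B *\<^sub>v u k + P *\<^sub>v w k"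
    and y_out: "\<And>k. k \<le> T \<Longrightarrow> y k = C *\<^sub>v x k + Q *\<^sub>v w k"
    and \<eta>_step: "\<And>k. k \<le> T \<Longrightarrow> \<eta> (Suc k) = im_Phi p q *\<^sub>v \<eta> k + im_G p q *\<^sub>v y k"
    and N: "N = (m + p) * l + p * degree q"
    and g: "dim_vec g = Suc T - l"
    and annihilated: "data_mat nw w l T *\<^sub>v g = 0\<^sub>v nw"
  shows "data_mat N (psi_vec p m l y u \<eta>) (l + 1) (T + 1) *\<^sub>v g =
    Abar_mat p m l q (Z1_mat A B C l OL) *\<^sub>v (data_mat N (psi_vec p m l y u \<eta>) l T *\<^sub>v g) +
    Bbar_mat p m l q *\<^sub>v (data_mat m u l T *\<^sub>v g)"
proof -
  let ?d = "p * degree q" and ?Z = "Z1_mat A B C l OL"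
  let ?w = "superposition nw g w" and ?x = "superposition n g x"
    and ?u = "superposition m g u" and ?y = "superposition p g y"
  have y: "y k \<in> carrier_vec p" if "k \<le> T" for k
    using mult_mat_vec_carrier[OF C x] mult_mat_vec_carrier[OF Q w] that
    by (simp add: y_out)
  have le: "i + c \<le> T" if "i \<le> l" "c < dim_vec g" for i c
    using that g T by simp
  have N': "N = p * l + (m * l + ?d)" using N by (simp add: algebra_simps)

  \<comment> \<open>Superposition commutes with the exosystem, so \<open>S\<close> can be cancelled step by step, from the
    end of the window, where the exosignal vanishes, back to its start.\<close>
  have w_sup: "?w (Suc i) = S *\<^sub>v ?w i" if "i \<le> l" for i
  proof -
    have "?w (Suc i) = superposition nw g (\<lambda>k. S *\<^sub>v w k) i"
      using le[OF that] by (intro superposition_cong) (simp add: w_step)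
    also have "\<dots> = S *\<^sub>v ?w i"
      by (intro mult_mat_superposition[OF S] w le_SucI le[OF that])
    finally show ?thesis .
  qed
  have w0: "?w i = 0\<^sub>v nw" if "i \<le> l" for i
    using that
  proof (induction i rule: inc_induct)
    case base
    have "data_mat nw w l T *\<^sub>v g = ?w l"
      using g by (intro data_mat_mult_vec w le_SucI le) simp_all
    with annihilated show ?case by simp
  next
    case (step i)
    have "S *\<^sub>v ?w i = ?w (Suc i)" using step.hyps by (intro w_sup[symmetric]) simp
    then have "S *\<^sub>v ?w i = 0\<^sub>v nw" by (simp only: step.IH)
    then show ?case by (rule no_zero_eigenvalue_imp_kernel_trivial[OF S S_inj superposition_carrier])
  qed

  have x_sup: "?x (Suc i) = A *\<^sub>v ?x i + B *\<^sub>v ?u i" if i: "i < l" for i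
  proof -
    have le': "i + c \<le> T" if "c < dim_vec g" for c using le[of i c] i that by simp
    note c = x[OF le_SucI[OF le']] u[OF le'] w[OF le_SucI[OF le']]
    note Mc = mult_mat_vec_carrier[OF A c(1)] mult_mat_vec_carrier[OF B c(2)]
      mult_mat_vec_carrier[OF P c(3)]
    have "?x (Suc i) = superposition n g (\<lambda>k. A *\<^sub>v x k + B *\<^sub>v u k + P *\<^sub>v w k) i"
      using le' by (intro superposition_cong) (simp add: x_step)
    also have "\<dots> = A *\<^sub>v ?x i + B *\<^sub>v ?u i + P *\<^sub>v ?w i"
      using Mc c by (simp only: superposition_add[of g _ i n] add_carrier_vec
          mult_mat_superposition[OF A, of g x i] mult_mat_superposition[OF B, of g u i]
          mult_mat_superposition[OF P, of g w i])
    also have "P *\<^sub>v ?w i = 0\<^sub>v n" using w0[of i] i P by auto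
    finally show ?thesis
      using mult_mat_vec_carrier[OF A, of "?x i"] mult_mat_vec_carrier[OF B, of "?u i"] by simp
  qed
  have y_sup: "?y i = C *\<^sub>v ?x i" if i: "i \<le> l" for i
  proof -
    note le' = le[OF i]
    note c = x[OF le_SucI[OF le']] w[OF le_SucI[OF le']]
    note Mc = mult_mat_vec_carrier[OF C c(1)] mult_mat_vec_carrier[OF Q c(2)]
    have "?y i = superposition p g (\<lambda>k. C *\<^sub>v x k + Q *\<^sub>v w k) i"
      using le' by (intro superposition_cong) (simp add: y_out)
    also have "\<dots> = C *\<^sub>v ?x i + Q *\<^sub>v ?w i"
      using Mc c by (simp only: superposition_add[of g _ i p]
          mult_mat_superposition[OF C, of g x i] mult_mat_superposition[OF Q, of g w i])
    also have "Q *\<^sub>v ?w i = 0\<^sub>v p" using w0[of i] i Q by auto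
    finally show ?thesis using mult_mat_vec_carrier[OF C, of "?x i"] by simp
  qed
  have pred: "?Z *\<^sub>v (stack_vec p l ?y @\<^sub>v stack_vec m l ?u) = ?y l"
  proof -
    have "stack_vec p l ?y = stack_vec p l (\<lambda>i. C *\<^sub>v ?x i)"
      by (rule stack_vec_cong) (simp add: y_sup)
    moreover have "?Z *\<^sub>v (stack_vec p l (\<lambda>i. C *\<^sub>v ?x i) @\<^sub>v stack_vec m l ?u) = C *\<^sub>v ?x l"
      by (rule output_prediction[OF A B C OL]) (simp_all add: x_sup)
    ultimately show ?thesis by (simp add: y_sup)
  qed

  \<comment> \<open>Both data matrices at once: \<open>s = 0\<close> is the window that ends before position \<open>l\<close>, and \<open>s = 1\<close>
    is its successor.\<close>
  have psi_sup: "data_mat N (psi_vec p m l y u \<eta>) (l + s) (T + s) *\<^sub>v g =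
      stack_vec p l (\<lambda>i. ?y (s + i)) @\<^sub>v stack_vec m l (\<lambda>i. ?u (s + i)) @\<^sub>v
        superposition ?d g \<eta> (l + s)" if s: "s \<le> 1" for s
  proof -
    have b: "s + i + c \<le> T" if "i < l" "c < dim_vec g" for i c
      using le[of "s + i" c] that s by simp
    have e: "l + s + c - l + i = s + i + c" for c i by simp
    have yc: "y (l + s + c - l + i) \<in> carrier_vec p" and uc: "u (l + s + c - l + i) \<in> carrier_vec m"
      if "i < l" "c < dim_vec g" for i c
      unfolding e using y u b[OF that] by auto
    have \<eta>c: "\<eta> (l + s + c) \<in> carrier_vec ?d" if "c < dim_vec g" for c
      using le[of l c] that s by (intro \<eta>) simp
    have psi: "psi_vec p m l y u \<eta> (l + s + c) \<in> carrier_vec N" if "c < dim_vec g" for c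
      unfolding psi_vec_def N' using \<eta>c[OF that] by simp
    have "data_mat N (psi_vec p m l y u \<eta>) (l + s) (T + s) *\<^sub>v g =
        superposition N g (psi_vec p m l y u \<eta>) (l + s)"
      using g by (intro data_mat_mult_vec psi) simp_all
    also have "\<dots> =
      superposition (p * l) g (\<lambda>k. stack_vec p l (\<lambda>i. y (k - l + i))) (l + s) @\<^sub>v
      superposition (m * l) g (\<lambda>k. stack_vec m l (\<lambda>i. u (k - l + i))) (l + s) @\<^sub>v
      superposition ?d g \<eta> (l + s)"
      unfolding N' psi_vec_def using \<eta>c by (simp add: superposition_append)
    also have "superposition (p * l) g (\<lambda>k. stack_vec p l (\<lambda>i. y (k - l + i))) (l + s) =
        stack_vec p l (\<lambda>i. superposition p g (\<lambda>k. y (k - l + i)) (l + s))"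
      by (rule superposition_stack) (rule yc)
    also have "\<dots> = stack_vec p l (\<lambda>i. ?y (s + i))"
      by (intro stack_vec_cong superposition_cong) (simp only: e)
    also have "superposition (m * l) g (\<lambda>k. stack_vec m l (\<lambda>i. u (k - l + i))) (l + s) =
        stack_vec m l (\<lambda>i. superposition m g (\<lambda>k. u (k - l + i)) (l + s))"
      by (rule superposition_stack) (rule uc)
    also have "\<dots> = stack_vec m l (\<lambda>i. ?u (s + i))"
      by (intro stack_vec_cong superposition_cong) (simp only: e)
    finally show ?thesis .
  qed

  have \<eta>_sup: "superposition ?d g \<eta> (Suc l) = im_Phi p q *\<^sub>v superposition ?d g \<eta> l + im_G p q *\<^sub>v ?y l"
  proof -
    note le' = le[OF order_refl]
    note c = \<eta>[OF le_SucI[OF le']] y[OF le']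
    note Mc = mult_mat_vec_carrier[OF im_Phi_carrier c(1)] mult_mat_vec_carrier[OF im_G_carrier c(2)]
    have "superposition ?d g \<eta> (Suc l) = superposition ?d g (\<lambda>k. im_Phi p q *\<^sub>v \<eta> k + im_G p q *\<^sub>v y k) l"
      using le' by (intro superposition_cong) (simp add: \<eta>_step)
    also have "\<dots> = im_Phi p q *\<^sub>v superposition ?d g \<eta> l + im_G p q *\<^sub>v ?y l"
      using Mc c by (simp only: superposition_add[of g _ l ?d]
          mult_mat_superposition[OF im_Phi_carrier, of g \<eta> l] mult_mat_superposition[OF im_G_carrier, of g y l])
    finally show ?thesis .
  qed
  have U: "data_mat m u l T *\<^sub>v g = ?u l"
    using g by (intro data_mat_mult_vec u le) simp_all

  show ?thesis
    using lifted_step[OF Z1_mat_carrier[OF A B C OL(1)], of ?y ?u "superposition ?d g \<eta> l" q] pred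
      psi_sup[of 0] psi_sup[of 1]
    by (simp add: U \<eta>_sup)
qed

lemma col_append_rows:
  assumes "M1 \<in> carrier_mat k c" "M2 \<in> carrier_mat k' c" "j < c"
  shows "col (M1 @\<^sub>r M2) j = col M1 j @\<^sub>v col M2 j"
  using assms unfolding append_rows_def
  by (intro col_four_block_mat(1)[of _ k c _ 0 _ k']) auto

theorem lemma3p5:
  fixes n nw m p l T nwh N :: nat
    and S A B P C Q OL L0 M \<K> \<G> U1 \<Psi>0 \<Psi>1 W0 Z1 :: "real mat"
    and q :: "real poly"
    and w x u y \<eta> :: "nat \<Rightarrow> real vec"
  assumes S: "S \<in> carrier_mat nw nw"
    and A: "A \<in> carrier_mat n n"
    and B: "B \<in> carrier_mat n m"
    and P: "P \<in> carrier_mat n nw"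
    and C: "C \<in> carrier_mat p n"
    and Q: "Q \<in> carrier_mat p nw"
    and eig: "\<And>z. eigenvalue (map_mat complex_of_real S) z \<Longrightarrow> 1 \<le> cmod z"
    and obs: "observable A C"
    and ind: "is_obsv_index A C l"
    and q: "is_min_poly S q"
    and OL: "OL \<in> carrier_mat n (p * l)" "OL * obsv_mat A C l = 1\<^sub>m n"
    and T: "l \<le> T"
    and w0: "w 0 \<in> carrier_vec nw"
    and x0: "x 0 \<in> carrier_vec n"
    and \<eta>0: "\<eta> 0 \<in> carrier_vec (p * degree q)"
    and u: "\<And>k. k \<le> T \<Longrightarrow> u k \<in> carrier_vec m"
    and w_step: "\<And>k. k \<le> T \<Longrightarrow> w (Suc k) = S *\<^sub>v w k"
    and x_step: "\<And>k. k \<le> T \<Longrightarrow> x (Suc k) = A *\<^sub>v x k + B *\<^sub>v u k + P *\<^sub>v w k"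
    and y_out: "\<And>k. k \<le> T \<Longrightarrow> y k = C *\<^sub>v x k + Q *\<^sub>v w k"
    and \<eta>_step: "\<And>k. k \<le> T \<Longrightarrow> \<eta> (Suc k) = im_Phi p q *\<^sub>v \<eta> k + im_G p q *\<^sub>v y k"
    and N: "N = (m + p) * l + p * degree q"
    and U1: "U1 = data_mat m u l T"
    and \<Psi>0: "\<Psi>0 = data_mat N (psi_vec p m l y u \<eta>) l T"
    and \<Psi>1: "\<Psi>1 = data_mat N (psi_vec p m l y u \<eta>) (l + 1) (T + 1)"
    and W0: "W0 = data_mat nw w l T"
    and Z1: "Z1 = Z1_mat A B C l OL"
    and L0: "L0 \<in> carrier_mat nw nwh"
    and M: "M \<in> carrier_mat nwh (T - l + 1)"
    and W0_fact: "W0 = L0 * M"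
    and \<K>: "\<K> \<in> carrier_mat m N"
    and \<G>: "\<G> \<in> carrier_mat (T - l + 1) N"
    and data_eq: "\<K> @\<^sub>r 1\<^sub>m N @\<^sub>r 0\<^sub>m nwh N = (U1 @\<^sub>r \<Psi>0 @\<^sub>r M) * \<G>"
  shows "Abar_mat p m l q Z1 + Bbar_mat p m l q * \<K> = \<Psi>1 * \<G>"
proof -
  let ?s = "T - l + 1" and ?d = "p * degree q"
  let ?A = "Abar_mat p m l q Z1" and ?B = "Bbar_mat p m l q"
  have N': "p * l + m * l + ?d = N" using N by (simp add: algebra_simps)
  have Abar: "?A \<in> carrier_mat N N"
    using Abar_mat_carrier[OF Z1_mat_carrier[OF A B C OL(1)], of q] unfolding Z1 N' .
  have Bbar: "?B \<in> carrier_mat N m"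
    using Bbar_mat_carrier[of p m l q] unfolding N' .
  have s: "Suc T - l = ?s" using T by simp
  have U1c: "U1 \<in> carrier_mat m ?s" and \<Psi>0c: "\<Psi>0 \<in> carrier_mat N ?s"
    and \<Psi>1c: "\<Psi>1 \<in> carrier_mat N ?s" and W0c: "W0 \<in> carrier_mat nw ?s"
    using data_mat_carrier[of m u l T] data_mat_carrier[of N "psi_vec p m l y u \<eta>" l T]
      data_mat_carrier[of N "psi_vec p m l y u \<eta>" "l + 1" "T + 1"] data_mat_carrier[of nw w l T] s
    by (simp_all add: U1 \<Psi>0 \<Psi>1 W0)

  have w: "w k \<in> carrier_vec nw" if "k \<le> Suc T" for k
    using that
  proof (induction k)
    case (Suc k)
    then show ?case using w_step[of k] mult_mat_vec_carrier[OF S] by simp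
  qed (rule w0)
  have x: "x k \<in> carrier_vec n" if "k \<le> Suc T" for k
    using that
  proof (induction k)
    case (Suc k)
    then have k: "k \<le> T" by simp
    show ?case
      unfolding x_step[OF k]
      by (intro add_carrier_vec mult_mat_vec_carrier[OF A] mult_mat_vec_carrier[OF B]
          mult_mat_vec_carrier[OF P] Suc.IH u w) (use k in simp_all)
  qed (rule x0)
  have \<eta>: "\<eta> k \<in> carrier_vec ?d" if "k \<le> Suc T" for k
    using that
  proof (induction k)
    case (Suc k)
    then have k: "k \<le> T" by simp
    show ?case
      unfolding \<eta>_step[OF k] y_out[OF k]
      by (intro add_carrier_vec mult_mat_vec_carrier[OF im_Phi_carrier]
          mult_mat_vec_carrier[OF im_G_carrier] mult_mat_vec_carrier[OF C]
          mult_mat_vec_carrier[OF Q] Suc.IH x w) (use k in simp_all)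
  qed (rule \<eta>0)
  have S_inj: "\<not> eigenvalue (map_mat complex_of_real S) 0" using eig[of 0] by auto

  show ?thesis
  proof (rule mat_col_eqI)
    fix j assume "j < dim_col (\<Psi>1 * \<G>)"
    then have j: "j < N" using \<G> by simp
    let ?g = "col \<G> j"
    have g: "?g \<in> carrier_vec ?s" using \<G> by (intro carrier_vecI) simp
    have \<Psi>0M: "\<Psi>0 @\<^sub>r M \<in> carrier_mat (N + nwh) ?s" by (rule carrier_append_rows[OF \<Psi>0c M])
    \<comment> \<open>The \<open>j\<close>-th column of the data equation, split into its three block rows.\<close>
    have "col \<K> j @\<^sub>v unit_vec N j @\<^sub>v 0\<^sub>v nwh = col (\<K> @\<^sub>r 1\<^sub>m N @\<^sub>r 0\<^sub>m nwh N) j"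
      using j by (simp add: col_append_rows[OF \<K> carrier_append_rows[OF one_carrier_mat zero_carrier_mat]]
          col_append_rows[OF one_carrier_mat zero_carrier_mat])
    also have "\<dots> = (U1 @\<^sub>r \<Psi>0 @\<^sub>r M) *\<^sub>v ?g"
      unfolding data_eq by (rule col_mult2[OF carrier_append_rows[OF U1c \<Psi>0M] \<G> j])
    also have "\<dots> = U1 *\<^sub>v ?g @\<^sub>v \<Psi>0 *\<^sub>v ?g @\<^sub>v M *\<^sub>v ?g"
      by (simp only: mat_mult_append[OF U1c \<Psi>0M g] mat_mult_append[OF \<Psi>0c M g])
    finally have "col \<K> j @\<^sub>v unit_vec N j @\<^sub>v 0\<^sub>v nwh = U1 *\<^sub>v ?g @\<^sub>v \<Psi>0 *\<^sub>v ?g @\<^sub>v M *\<^sub>v ?g" .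
    moreover have "col \<K> j \<in> carrier_vec m" using \<K> by (intro carrier_vecI) simp
    ultimately have K: "U1 *\<^sub>v ?g = col \<K> j" and I: "\<Psi>0 *\<^sub>v ?g = unit_vec N j"
      and "M *\<^sub>v ?g = 0\<^sub>v nwh"
      by (simp_all add: append_vec_eq[OF _ mult_mat_vec_carrier[OF U1c g]]
          append_vec_eq[OF unit_vec_carrier mult_mat_vec_carrier[OF \<Psi>0c g]])
    then have "W0 *\<^sub>v ?g = 0\<^sub>v nw"
      unfolding W0_fact using assoc_mult_mat_vec[OF L0 M g] L0 by auto
    then have "\<Psi>1 *\<^sub>v ?g = ?A *\<^sub>v (\<Psi>0 *\<^sub>v ?g) + ?B *\<^sub>v (U1 *\<^sub>v ?g)"
      unfolding \<Psi>0 \<Psi>1 U1 W0 Z1 using g s \<G>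
      by (intro lifted_step_superposition[where w = w and x = x and u = u and y = y and \<eta> = \<eta>, OF S S_inj A B P C Q OL T w x u \<eta> w_step x_step y_out \<eta>_step N])
        simp_all
    also have "\<dots> = col ?A j + col (?B * \<K>) j"
      using col_mult2[OF Abar one_carrier_mat j] Abar j by (simp add: K I col_mult2[OF Bbar \<K> j])
    also have "\<dots> = col (?A + ?B * \<K>) j"
      by (rule col_add[symmetric, OF Abar mult_carrier_mat[OF Bbar \<K>] j])
    finally show "col (?A + ?B * \<K>) j = col (\<Psi>1 * \<G>) j"
      by (simp only: col_mult2[OF \<Psi>1c \<G> j])
  qed (use Abar Bbar \<K> \<Psi>1c \<G> in simp_all)
qed

end
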